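(* Let $A,B$ be commutative $\mathbb{R}$-algebras with $1$, $X$ a compact Hausdorff space, and $\varphi\colon B\to A$ and $\ \widehat{}\ \colon B\to C(X,\mathbb{R})$ algebra homomorphisms such that the image $\widehat{B}$ separates points of $X$. Let $M\subseteq A$ be a quadratic module and assume $\varphi(b)\in M$ whenever $b\in B$ satisfies $\hat{b}>0$ on $X$. Then for any finitely generated $B$-submodule $W$ of $A$ we have $$\bigcap_{x\in X}\bigl(M+J_x(W)\bigr)\subseteq M^{\ddagger}.$$
   Context: Algebra homomorphisms are $\mathbb{R}$-algebra homomorphisms mapping $1$ to $1$; $C(X,\mathbb{R})$ is the algebra of continuous real functions on $X$. $\widehat{B}$ separates points of $X$ if for any distinct $x,y\in X$ there is $b\in B$ with $\hat{b}(x)\neq\hat{b}(y)$. A quadratic module in $A$ is a set $M\subseteq A$ with $M+M\subseteq M$, $1\in M$ and $a^2m\in M$ for all $a\in A$, $m\in M$. $A$ is regarded as a $B$-module via $\varphi$. For $x\in X$ let $I_x=\{b\in B\mid \hat{b}(x)=0\}$, and for a $B$-submodule $W$ of $A$ let $J_x(W)=\{\sum_{i=1}^n w_i\varphi(b_i)\mid n\in\mathbb{N},\ w_i\in W,\ b_i\in I_x\}$. Finally $M^{\ddagger}=\{f\in A\mid \exists q\in A\ \forall \varepsilon>0:\ f+\varepsilon q\in M\}$ (the sequential closure of $M$ in the finest locally convex topology on $A$). *)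

theory Defs
  imports "HOL-Analysis.Analysis" "HOL-Library.Set_Algebras"
begin

text \<open>
  Commutative real algebras with 1 are the types of sort
  \<open>{real_algebra, comm_ring, comm_monoid_mult}\<close>. Unlike \<open>{real_algebra_1, comm_ring_1}\<close>,
  this sort does not impose \<open>0 \<noteq> 1\<close>, so the zero algebra is included.
\<close>

definition real_alg_hom ::
    "('b::{real_algebra, comm_ring, comm_monoid_mult} \<Rightarrow>
      'a::{real_algebra, comm_ring, comm_monoid_mult}) \<Rightarrow> bool" where
  "real_alg_hom h \<longleftrightarrow> linear h \<and> (\<forall>x y. h (x * y) = h x * h y) \<and> h 1 = 1"

text \<open>
  Elements of \<open>C(X,\<real>)\<close> are represented by functions on the ambient type, with values outside
  \<open>X\<close> irrelevant. The operations of \<open>C(X,\<real>)\<close> are pointwise, so a map into it is an algebra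
  homomorphism iff its composition with each point evaluation is one. The set \<open>X\<close> may be empty.
\<close>

definition real_alg_hom_into_C ::
    "'x::t2_space set \<Rightarrow>
     ('b::{real_algebra, comm_ring, comm_monoid_mult} \<Rightarrow> 'x \<Rightarrow> real) \<Rightarrow> bool" where
  "real_alg_hom_into_C X hat \<longleftrightarrow>
     (\<forall>b. continuous_on X (hat b)) \<and> (\<forall>x\<in>X. real_alg_hom (\<lambda>b. hat b x))"

definition image_separates_points :: "'x set \<Rightarrow> ('b \<Rightarrow> 'x \<Rightarrow> real) \<Rightarrow> bool" where
  "image_separates_points X hat \<longleftrightarrow> (\<forall>x\<in>X. \<forall>y\<in>X. x \<noteq> y \<longrightarrow> (\<exists>b. hat b x \<noteq> hat b y))"

definition quadratic_module ::
    "'a::{real_algebra, comm_ring, comm_monoid_mult} set \<Rightarrow> bool" where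
  "quadratic_module M \<longleftrightarrow> M + M \<subseteq> M \<and> 1 \<in> M \<and> (\<forall>a. \<forall>m\<in>M. a\<^sup>2 * m \<in> M)"

definition submodule_via ::
    "('b::{real_algebra, comm_ring, comm_monoid_mult} \<Rightarrow>
      'a::{real_algebra, comm_ring, comm_monoid_mult}) \<Rightarrow> 'a set \<Rightarrow> bool" where
  "submodule_via \<phi> W \<longleftrightarrow>
     0 \<in> W \<and> (\<forall>v\<in>W. \<forall>w\<in>W. v + w \<in> W) \<and> (\<forall>b. \<forall>w\<in>W. \<phi> b * w \<in> W)"

definition fin_gen_submodule_via ::
    "('b::{real_algebra, comm_ring, comm_monoid_mult} \<Rightarrow>
      'a::{real_algebra, comm_ring, comm_monoid_mult}) \<Rightarrow> 'a set \<Rightarrow> bool" where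
  "fin_gen_submodule_via \<phi> W \<longleftrightarrow>
     submodule_via \<phi> W \<and> (\<exists>S. finite S \<and> W = submodule_via \<phi> hull S)"

definition vanishing_ideal :: "('b \<Rightarrow> 'x \<Rightarrow> real) \<Rightarrow> 'x \<Rightarrow> 'b set" where
  "vanishing_ideal hat x = {b. hat b x = 0}"

definition J_at ::
    "('b \<Rightarrow> 'a::{real_algebra, comm_ring, comm_monoid_mult}) \<Rightarrow> ('b \<Rightarrow> 'x \<Rightarrow> real) \<Rightarrow>
     'x \<Rightarrow> 'a set \<Rightarrow> 'a set" where
  "J_at \<phi> hat x W =
     {(\<Sum>i<n. w i * \<phi> (b i)) | (n::nat) w b.
        \<forall>i<n. w i \<in> W \<and> b i \<in> vanishing_ideal hat x}"

definition ddagger :: "'a::{real_algebra, comm_ring, comm_monoid_mult} set \<Rightarrow> 'a set" where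
  "ddagger M = {f. \<exists>q. \<forall>\<epsilon>>0. f + \<epsilon> *\<^sub>R q \<in> M}"

end

theory Submission
  imports Defs
begin

text \<open>
  Let \<open>f\<close> lie in every \<open>M + J\<^sub>x(W)\<close>, and let the finite set \<open>S\<close> generate \<open>W\<close>. Over each point
  \<open>x\<close> of \<open>X\<close> there is a representation \<open>f = m\<^sub>x + \<Sum>\<^sub>s s \<phi>(c\<^sub>x\<^sub>s)\<close> with \<open>m\<^sub>x \<in> M\<close> and
  \<open>c\<^sub>x\<^sub>s\<close> vanishing at \<open>x\<close> (\<open>J_at_as_combinations\<close>). The error terms are small near \<open>x\<close>, so the
  local representations are glued with a partition of unity that uses each \<open>x\<close> only where its
  coefficients \<open>c\<^sub>x\<^sub>s\<close> are small. To stay inside \<open>M\<close> the weights have to be squares of elements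
  coming from \<open>B\<close>; the Stone-Weierstrass theorem supplies \<open>b\<^sub>x \<in> B\<close> whose squares are almost such
  a partition (\<open>square_weights_in_algebra\<close>). Then
  \<open>f = \<Sum>\<^sub>x \<phi>(b\<^sub>x)\<^sup>2 m\<^sub>x + \<Sum>\<^sub>s s \<phi>(v\<^sub>s) + f \<phi>(u)\<close>, where \<open>v\<^sub>s = \<Sum>\<^sub>x b\<^sub>x\<^sup>2 c\<^sub>x\<^sub>s\<close> and
  \<open>u = 1 - \<Sum>\<^sub>x b\<^sub>x\<^sup>2\<close> are uniformly smaller than \<open>\<epsilon>\<close> on \<open>X\<close>.

  The first sum lies in \<open>M\<close>. A term \<open>w \<phi>(c)\<close> with \<open>c\<close> smaller than \<open>\<epsilon>\<close> enters \<open>M\<close> after adding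
  \<open>\<epsilon> (w\<^sup>2 + 1)/2\<close> (\<open>perturbation_in_quadratic_module\<close>), and this correction depends on \<open>c\<close>
  only through \<open>\<epsilon>\<close>. Hence \<open>q = (f\<^sup>2 + 1)/2 + \<Sum>\<^sub>s (s\<^sup>2 + 1)/2\<close> works for all \<open>\<epsilon>\<close> at once.
  This uniformity is where finite generation of \<open>W\<close> enters: \<open>S\<close> is the same for all \<open>x\<close> and all
  \<open>\<epsilon>\<close>.
\<close>

section \<open>Homomorphisms and quadratic modules\<close>

lemma real_alg_hom_simps:
  assumes "real_alg_hom h"
  shows "h (x + y) = h x + h y" "h (x * y) = h x * h y" "h (r *\<^sub>R x) = r *\<^sub>R h x"
    "h 0 = 0" "h 1 = 1" "h (- x) = - h x" "h (x - y) = h x - h y" "h (x\<^sup>2) = (h x)\<^sup>2"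
    "h (sum g F) = (\<Sum>i\<in>F. h (g i))"
  using assms unfolding real_alg_hom_def
  by (auto simp: linear_add linear_scale linear_0 linear_neg linear_diff linear_sum power2_eq_square)

lemma quadratic_module_add:
  "quadratic_module M \<Longrightarrow> u \<in> M \<Longrightarrow> v \<in> M \<Longrightarrow> u + v \<in> M"
  unfolding quadratic_module_def by (auto intro: set_plus_intro)

lemma quadratic_module_square_mult:
  "quadratic_module M \<Longrightarrow> m \<in> M \<Longrightarrow> a\<^sup>2 * m \<in> M"
  unfolding quadratic_module_def by blast

lemma quadratic_module_sum:
  assumes "quadratic_module M" "\<And>i. i \<in> F \<Longrightarrow> g i \<in> M"
  shows "sum g F \<in> M"
proof -
  have "0 \<in> M"
    using quadratic_module_square_mult[OF assms(1), of 1 0] assms(1)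
    by (simp add: quadratic_module_def power2_eq_square)
  then show ?thesis
    using assms(2)
    by (induction F rule: infinite_finite_induct) (auto intro: quadratic_module_add[OF assms(1)])
qed

text \<open>
  From \<open>4w = (w + 1)\<^sup>2 - (w - 1)\<^sup>2\<close> and \<open>2(w\<^sup>2 + 1) = (w + 1)\<^sup>2 + (w - 1)\<^sup>2\<close>. It trades a product with
  an arbitrary \<open>w\<close> for square multiples of \<open>e + c\<close> and \<open>e - c\<close>, both of which are positive when
  \<open>c\<close> is small against \<open>e\<close>. The underlying sort has no numerals, so that the proof splits \<open>x\<close>
  into quarters by hand.
\<close>

lemma mult_as_difference_of_squares:
  fixes w c e :: "'a::{real_algebra, comm_ring, comm_monoid_mult}"
  shows "w * c + ((1/2) *\<^sub>R (w\<^sup>2 + 1)) * e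
    = ((1/2) *\<^sub>R (w + 1))\<^sup>2 * (e + c) + ((1/2) *\<^sub>R (w - 1))\<^sup>2 * (e - c)"
proof -
  have four: "x = (1/4) *\<^sub>R x + (1/4) *\<^sub>R x + (1/4) *\<^sub>R x + (1/4) *\<^sub>R x" for x :: 'a
    by (simp flip: scaleR_add_left)
  have half: "(1/2) *\<^sub>R x = (1/4) *\<^sub>R x + (1/4) *\<^sub>R x" for x :: 'a
    by (simp flip: scaleR_add_left)
  have "((1/2) *\<^sub>R (w\<^sup>2 + 1)) * e
      = (1/4) *\<^sub>R (w * w * e) + (1/4) *\<^sub>R (w * w * e) + ((1/4) *\<^sub>R e + (1/4) *\<^sub>R e)"
    unfolding half by (simp add: power2_eq_square algebra_simps)
  then show ?thesis
    by (subst four[of "w * c"]) (simp add: power2_eq_square algebra_simps)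
qed

text \<open>
  Smallness of \<open>c\<close> makes \<open>\<epsilon> + c\<close> and \<open>\<epsilon> - c\<close> positive on \<open>X\<close>, hence puts their images into
  \<open>M\<close>, and the preceding identity combines the two with square coefficients.
\<close>

lemma perturbation_in_quadratic_module:
  assumes \<phi>: "real_alg_hom \<phi>" and hat: "\<And>x. x \<in> X \<Longrightarrow> real_alg_hom (\<lambda>b. hat b x)"
    and M: "quadratic_module M"
    and pos: "\<And>b. (\<forall>x\<in>X. hat b x > 0) \<Longrightarrow> \<phi> b \<in> M"
    and small: "\<And>x. x \<in> X \<Longrightarrow> \<bar>hat c x\<bar> < \<epsilon>"
  shows "w * \<phi> c + \<epsilon> *\<^sub>R ((1/2) *\<^sub>R (w\<^sup>2 + 1)) \<in> M"
proof -
  have "hat (\<epsilon> *\<^sub>R 1 + c) x > 0" "hat (\<epsilon> *\<^sub>R 1 - c) x > 0" if "x \<in> X" for x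
    using small[OF that] real_alg_hom_simps[OF hat[OF that]] by auto
  then have "\<phi> (\<epsilon> *\<^sub>R 1 + c) \<in> M" "\<phi> (\<epsilon> *\<^sub>R 1 - c) \<in> M"
    using pos by blast+
  then have "\<epsilon> *\<^sub>R 1 + \<phi> c \<in> M" "\<epsilon> *\<^sub>R 1 - \<phi> c \<in> M"
    by (simp_all add: real_alg_hom_simps[OF \<phi>])
  then have "((1/2) *\<^sub>R (w + 1))\<^sup>2 * (\<epsilon> *\<^sub>R 1 + \<phi> c) + ((1/2) *\<^sub>R (w - 1))\<^sup>2 * (\<epsilon> *\<^sub>R 1 - \<phi> c) \<in> M"
    by (rule quadratic_module_add[OF M quadratic_module_square_mult[OF M] quadratic_module_square_mult[OF M]])
  then show ?thesis
    using mult_as_difference_of_squares[of w "\<phi> c" "\<epsilon> *\<^sub>R 1"] by simp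
qed

section \<open>Elements of finitely generated submodules\<close>

lemma hull_as_combinations:
  assumes \<phi>: "real_alg_hom \<phi>" and "finite S" and "w \<in> submodule_via \<phi> hull S"
  shows "\<exists>c. w = (\<Sum>s\<in>S. s * \<phi> (c s))"
proof -
  define T where "T = {w. \<exists>c. w = (\<Sum>s\<in>S. s * \<phi> (c s))}"
  have "s \<in> T" if "s \<in> S" for s
  proof -
    have "(\<Sum>t\<in>S. t * \<phi> (if t = s then 1 else 0)) = (\<Sum>t\<in>S. if t = s then t else 0)"
      by (intro sum.cong refl) (simp add: real_alg_hom_simps[OF \<phi>])
    then have "s = (\<Sum>t\<in>S. t * \<phi> (if t = s then 1 else 0))"
      using that \<open>finite S\<close> by simp
    then show ?thesis
      unfolding T_def mem_Collect_eq by (rule exI[of _ "\<lambda>t. if t = s then 1 else 0"])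
  qed
  moreover have "submodule_via \<phi> T"
    unfolding submodule_via_def
  proof (intro conjI ballI allI)
    show "0 \<in> T"
      unfolding T_def by (auto intro!: exI[of _ "\<lambda>_. 0"] simp: real_alg_hom_simps[OF \<phi>])
    show "v + w \<in> T" if vw: "v \<in> T" "w \<in> T" for v w
    proof -
      obtain c d where "v = (\<Sum>s\<in>S. s * \<phi> (c s))" "w = (\<Sum>s\<in>S. s * \<phi> (d s))"
        using vw unfolding T_def by blast
      then have "v + w = (\<Sum>s\<in>S. s * \<phi> (c s + d s))"
        by (simp add: real_alg_hom_simps[OF \<phi>] distrib_left sum.distrib)
      then show ?thesis unfolding T_def by (auto intro!: exI[of _ "\<lambda>s. c s + d s"])
    qed
    show "\<phi> b * w \<in> T" if w: "w \<in> T" for b w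
    proof -
      obtain c where "w = (\<Sum>s\<in>S. s * \<phi> (c s))"
        using w unfolding T_def by blast
      then have "\<phi> b * w = (\<Sum>s\<in>S. s * \<phi> (b * c s))"
        by (simp add: real_alg_hom_simps[OF \<phi>] sum_distrib_left mult.left_commute)
      then show ?thesis unfolding T_def by (auto intro!: exI[of _ "\<lambda>s. b * c s"])
    qed
  qed
  ultimately have "submodule_via \<phi> hull S \<subseteq> T"
    by (intro hull_minimal) auto
  then show ?thesis using assms(3) unfolding T_def by blast
qed

text \<open>
  Rewriting every element of \<open>W\<close> in terms of the generators bounds the number of summands by the
  size of \<open>S\<close>; the new coefficients still vanish at \<open>x\<close> because \<open>I\<^sub>x\<close> is an ideal.
\<close>

lemma J_at_as_combinations:
  assumes \<phi>: "real_alg_hom \<phi>" and hat: "real_alg_hom (\<lambda>b. hat b x)"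
    and S: "finite S" and j: "j \<in> J_at \<phi> hat x (submodule_via \<phi> hull S)"
  shows "\<exists>c. (\<forall>s. hat (c s) x = 0) \<and> j = (\<Sum>s\<in>S. s * \<phi> (c s))"
proof -
  obtain n :: nat and w b where j: "j = (\<Sum>i<n. w i * \<phi> (b i))"
    and wb: "\<And>i. i < n \<Longrightarrow> w i \<in> submodule_via \<phi> hull S" "\<And>i. i < n \<Longrightarrow> hat (b i) x = 0"
    using j unfolding J_at_def vanishing_ideal_def by auto
  obtain d where d: "\<And>i. i < n \<Longrightarrow> w i = (\<Sum>s\<in>S. s * \<phi> (d i s))"
    using hull_as_combinations[OF \<phi> S wb(1)] by metis
  have "j = (\<Sum>i<n. \<Sum>s\<in>S. s * \<phi> (d i s * b i))"
    unfolding j by (intro sum.cong refl) (simp add: d sum_distrib_right real_alg_hom_simps[OF \<phi>] mult.assoc)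
  also have "\<dots> = (\<Sum>s\<in>S. s * \<phi> (\<Sum>i<n. d i s * b i))"
    by (subst sum.swap) (simp add: real_alg_hom_simps(9)[OF \<phi>] sum_distrib_left)
  finally show ?thesis
    using wb(2) by (intro exI[of _ "\<lambda>s. \<Sum>i<n. d i s * b i"]) (simp add: real_alg_hom_simps[OF hat])
qed

section \<open>Partitions of unity by squares\<close>

lemma compact_finite_positive_sum:
  fixes g :: "'x \<Rightarrow> 'x::topological_space \<Rightarrow> real"
  assumes X: "compact X"
    and cont: "\<And>x. x \<in> X \<Longrightarrow> continuous_on X (g x)"
    and nonneg: "\<And>x y. g x y \<ge> 0" and diag: "\<And>x. x \<in> X \<Longrightarrow> g x x > 0"
  obtains F where "finite F" "F \<subseteq> X" "\<And>y. y \<in> X \<Longrightarrow> (\<Sum>x\<in>F. g x y) > 0"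
proof -
  have "\<exists>U. open U \<and> U \<inter> X = g x -` {0<..} \<inter> X" if "x \<in> X" for x
    using cont[OF that] open_greaterThan unfolding continuous_on_open_invariant by blast
  then obtain U where U: "\<And>x. x \<in> X \<Longrightarrow> open (U x)" 
    "\<And>x. x \<in> X \<Longrightarrow> U x \<inter> X = g x -` {0<..} \<inter> X"
    by metis
  have "X \<subseteq> (\<Union>x\<in>X. U x)"
    using U(2) diag by fastforce
  then obtain F where F: "F \<subseteq> X" "finite F" "X \<subseteq> (\<Union>x\<in>F. U x)"
    using compactE_image[OF X, of X U] U(1) by metis
  have "(\<Sum>x\<in>F. g x y) > 0" if y: "y \<in> X" for y
  proof -
    obtain x where "x \<in> F" "y \<in> U x"
      using F(3) y by blast
    then have "x \<in> F" "g x y > 0"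
      using U(2)[of x] F(1) y by auto
    then show ?thesis
      using F(2) nonneg by (intro sum_pos2[of F x]) auto
  qed
  with F that show thesis by blast
qed

text \<open>
  The cutoffs \<open>max 0 (\<epsilon> - \<Sum>\<^sub>s \<bar>k\<^sub>x\<^sub>s\<bar>)\<close> are continuous, positive at \<open>x\<close>, and nonzero only where
  all \<open>k\<^sub>x\<^sub>s\<close> are below \<open>\<epsilon>\<close>. Finitely many of them have a positive sum; dividing by it and taking
  square roots gives \<open>r\<close>. The last conclusion is then an average of numbers of modulus at most
  \<open>\<epsilon>\<close>.
\<close>

lemma square_partition_of_unity_concentrated_at_zeros:
  fixes k :: "'x \<Rightarrow> 's \<Rightarrow> 'x::topological_space \<Rightarrow> real"
  assumes X: "compact X" and S: "finite S" and \<epsilon>: "\<epsilon> > 0"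
    and cont: "\<And>x s. x \<in> X \<Longrightarrow> s \<in> S \<Longrightarrow> continuous_on X (k x s)"
    and zero: "\<And>x s. x \<in> X \<Longrightarrow> s \<in> S \<Longrightarrow> k x s x = 0"
  obtains F r where "finite F" "F \<subseteq> X" "\<And>x. x \<in> F \<Longrightarrow> continuous_on X (r x)"
    "\<And>y. y \<in> X \<Longrightarrow> (\<Sum>x\<in>F. (r x y)\<^sup>2) = (1::real)"
    "\<And>y s. y \<in> X \<Longrightarrow> s \<in> S \<Longrightarrow> \<bar>\<Sum>x\<in>F. (r x y)\<^sup>2 * k x s y\<bar> \<le> \<epsilon>"
proof -
  define g where "g x y = max 0 (\<epsilon> - (\<Sum>s\<in>S. \<bar>k x s y\<bar>))" for x y
  have g_nonneg: "g x y \<ge> 0" for x y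
    by (simp add: g_def)
  have g_cont: "continuous_on X (g x)" if "x \<in> X" for x
    unfolding g_def using cont that by (intro continuous_intros)
  have g_diag: "g x x > 0" if "x \<in> X" for x
    using zero that \<epsilon> by (simp add: g_def)
  have g_small: "g x y * \<bar>k x s y\<bar> \<le> g x y * \<epsilon>" if "s \<in> S" for x y s
  proof (cases "g x y = 0")
    case False
    have "\<bar>k x s y\<bar> \<le> (\<Sum>s\<in>S. \<bar>k x s y\<bar>)"
      using that S by (intro member_le_sum) auto
    also have "\<dots> \<le> \<epsilon>"
      using False by (auto simp: g_def max_def split: if_splits)
    finally show ?thesis
      using g_nonneg by (intro mult_left_mono)
  qed simp
  obtain F where F: "finite F" "F \<subseteq> X" "\<And>y. y \<in> X \<Longrightarrow> (\<Sum>x\<in>F. g x y) > 0"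
    using compact_finite_positive_sum[OF X g_cont g_nonneg g_diag] by metis
  define G where "G y = (\<Sum>x\<in>F. g x y)" for y
  define r where "r x y = sqrt (g x y / G y)" for x y
  have G_pos: "G y > 0" if "y \<in> X" for y
    using F(3)[OF that] by (simp add: G_def)
  have G_cont: "continuous_on X G"
    unfolding G_def using F(2) g_cont by (intro continuous_intros) auto
  have r_sq: "(r x y)\<^sup>2 = g x y / G y" if "y \<in> X" for x y
    using g_nonneg G_pos[OF that] by (simp add: r_def)
  show thesis
  proof
    show "finite F" "F \<subseteq> X" by (fact F)+
    show "continuous_on X (r x)" if "x \<in> F" for x
    proof -
      have "\<forall>y\<in>X. G y \<noteq> 0" using G_pos by force
      moreover have "x \<in> X" using that F(2) by blast
      ultimately show ?thesis
        unfolding r_def using g_cont G_cont by (intro continuous_intros)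
    qed
    show "(\<Sum>x\<in>F. (r x y)\<^sup>2) = 1" if "y \<in> X" for y
      using G_pos[OF that] by (simp add: r_sq[OF that] G_def flip: sum_divide_distrib)
    show "\<bar>\<Sum>x\<in>F. (r x y)\<^sup>2 * k x s y\<bar> \<le> \<epsilon>" if "y \<in> X" "s \<in> S" for y s
    proof -
      have "\<bar>\<Sum>x\<in>F. g x y * k x s y\<bar> \<le> (\<Sum>x\<in>F. \<bar>g x y * k x s y\<bar>)"
        by (rule sum_abs)
      also have "\<dots> \<le> (\<Sum>x\<in>F. g x y * \<epsilon>)"
        using g_small[OF \<open>s \<in> S\<close>] g_nonneg by (intro sum_mono) (simp add: abs_mult)
      also have "\<dots> = \<epsilon> * G y"
        by (simp add: G_def sum_distrib_left mult.commute)
      finally show ?thesis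
        using G_pos[OF \<open>y \<in> X\<close>] 
        by (simp add: r_sq[OF \<open>y \<in> X\<close>] field_simps flip: sum_divide_distrib)
    qed
  qed
qed

text \<open>
  Only values on \<open>X\<close> are controlled, whereas the Stone-Weierstrass theorem asks for a set of
  functions closed under the ring operations as functions on the whole type. Therefore it is
  applied to all functions that agree on \<open>X\<close> with a member of the image.
\<close>

lemma uniform_approximation_by_image:
  fixes hat :: "'b::{real_algebra, comm_ring, comm_monoid_mult} \<Rightarrow> 'x::t2_space \<Rightarrow> real"
  assumes X: "compact X" and hat: "real_alg_hom_into_C X hat"
    and sep: "image_separates_points X hat" and r: "continuous_on X r"
  shows "\<exists>b. uniform_limit X (\<lambda>n. hat (b n)) r sequentially"
proof -
  define R where "R = {f. \<exists>b. \<forall>x\<in>X. f x = hat b x}"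
  have hom: "real_alg_hom (\<lambda>b. hat b x)" if "x \<in> X" for x
    using hat that by (simp add: real_alg_hom_into_C_def)
  have cont: "continuous_on X (hat b)" for b
    using hat by (simp add: real_alg_hom_into_C_def)
  interpret function_ring_on R X
  proof
    show "compact X" by (fact X)
    show "continuous_on X f" if f: "f \<in> R" for f
    proof -
      obtain b where "\<forall>x\<in>X. f x = hat b x"
        using f unfolding R_def by blast
      then show ?thesis
        using cont[of b] by (metis continuous_on_cong)
    qed
    show "(\<lambda>x. f x + g x) \<in> R" if fg: "f \<in> R" "g \<in> R" for f g
    proof -
      obtain b c where "\<forall>x\<in>X. f x = hat b x" "\<forall>x\<in>X. g x = hat c x"
        using fg unfolding R_def by blast
      then have "\<forall>x\<in>X. f x + g x = hat (b + c) x"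
        using hom real_alg_hom_simps(1) by metis
      then show ?thesis unfolding R_def by blast
    qed
    show "(\<lambda>x. f x * g x) \<in> R" if fg: "f \<in> R" "g \<in> R" for f g
    proof -
      obtain b c where "\<forall>x\<in>X. f x = hat b x" "\<forall>x\<in>X. g x = hat c x"
        using fg unfolding R_def by blast
      then have "\<forall>x\<in>X. f x * g x = hat (b * c) x"
        using hom real_alg_hom_simps(2) by metis
      then show ?thesis unfolding R_def by blast
    qed
    show "(\<lambda>_. c) \<in> R" for c
    proof -
      have "\<forall>x\<in>X. c = hat (c *\<^sub>R 1) x"
        using real_alg_hom_simps(3,5)[OF hom] by simp
      then show ?thesis unfolding R_def by blast
    qed
    show "\<exists>f\<in>R. f x \<noteq> f y" if "x \<in> X" "y \<in> X" "x \<noteq> y" for x y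
      using sep that unfolding image_separates_points_def R_def by blast
  qed
  obtain p where "p \<in> UNIV \<rightarrow> R" and p: "uniform_limit X p r sequentially"
    using Stone_Weierstrass[OF r] by blast
  then have "\<exists>b. \<forall>x\<in>X. p n x = hat b x" for n
    unfolding R_def by blast
  then obtain b where "\<And>n x. x \<in> X \<Longrightarrow> p n x = hat (b n) x"
    by metis
  then have "uniform_limit X (\<lambda>n. hat (b n)) r sequentially"
    using p by (subst uniform_limit_cong'[where g = p and i = r]) auto
  then show ?thesis by blast
qed

lemma uniform_limit_weighted_sum_of_squares:
  fixes p :: "'x \<Rightarrow> nat \<Rightarrow> 'x::topological_space \<Rightarrow> real"
  assumes X: "compact X"
    and p: "\<And>x. x \<in> F \<Longrightarrow> uniform_limit X (p x) (r x) sequentially"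
    and r: "\<And>x. x \<in> F \<Longrightarrow> continuous_on X (r x)"
    and k: "\<And>x. x \<in> F \<Longrightarrow> continuous_on X (k x)"
  shows "uniform_limit X (\<lambda>n y. \<Sum>x\<in>F. (p x n y)\<^sup>2 * k x y)
           (\<lambda>y. \<Sum>x\<in>F. (r x y)\<^sup>2 * k x y) sequentially"
proof -
  have bnd: "bounded (h ` X)" if "continuous_on X h" for h :: "'x \<Rightarrow> real"
    using that X compact_continuous_image compact_imp_bounded by blast
  have "uniform_limit X (\<lambda>n y. (p x n y)\<^sup>2 * k x y) (\<lambda>y. (r x y)\<^sup>2 * k x y) sequentially"
    if x: "x \<in> F" for x
  proof -
    have "uniform_limit X (\<lambda>n y. p x n y * p x n y) (\<lambda>y. r x y * r x y) sequentially"
      using p[OF x] bnd[OF r[OF x]] by (intro uniform_lim_mult)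
    then show ?thesis
      unfolding power2_eq_square
      by (rule uniform_lim_mult[OF _ uniform_limit_const])
         (intro bnd continuous_intros r[OF x] k[OF x])+
  qed
  then show ?thesis
    by (induction F rule: infinite_finite_induct) (auto intro: uniform_limit_add uniform_limit_const)
qed

text \<open>
  Transfers the partition of unity from \<open>C(X,\<real>)\<close> to \<open>B\<close>. The conditions on the weights are
  finitely many, and each is a strict bound on an expression continuous in the weights with respect
  to uniform convergence, so that good enough approximations satisfy all of them.
\<close>

lemma square_weights_in_algebra:
  fixes hat :: "'b::{real_algebra, comm_ring, comm_monoid_mult} \<Rightarrow> 'x::t2_space \<Rightarrow> real"
  assumes X: "compact X" and hat: "real_alg_hom_into_C X hat"
    and sep: "image_separates_points X hat" and S: "finite S" and \<epsilon>: "\<epsilon> > 0"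
    and zero: "\<And>x s. x \<in> X \<Longrightarrow> s \<in> S \<Longrightarrow> hat (c x s) x = 0"
  obtains F b where "finite F" "F \<subseteq> X"
    "\<And>y. y \<in> X \<Longrightarrow> \<bar>hat (1 - (\<Sum>x\<in>F. (b x)\<^sup>2)) y\<bar> < \<epsilon>"
    "\<And>y s. y \<in> X \<Longrightarrow> s \<in> S \<Longrightarrow> \<bar>hat (\<Sum>x\<in>F. (b x)\<^sup>2 * c x s) y\<bar> < \<epsilon>"
proof -
  have hom: "real_alg_hom (\<lambda>b. hat b x)" if "x \<in> X" for x
    using hat that by (simp add: real_alg_hom_into_C_def)
  have cont: "continuous_on X (hat b)" for b
    using hat by (simp add: real_alg_hom_into_C_def)
  obtain F r where F: "finite F" "F \<subseteq> X" and r: "\<And>x. x \<in> F \<Longrightarrow> continuous_on X (r x)"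
    and r_one: "\<And>y. y \<in> X \<Longrightarrow> (\<Sum>x\<in>F. (r x y)\<^sup>2) = (1::real)"
    and r_small: "\<And>y s. y \<in> X \<Longrightarrow> s \<in> S \<Longrightarrow> \<bar>\<Sum>x\<in>F. (r x y)\<^sup>2 * hat (c x s) y\<bar> \<le> \<epsilon> / 2"
    using square_partition_of_unity_concentrated_at_zeros
        [OF X S, of "\<epsilon> / 2" "\<lambda>x s. hat (c x s)"] \<epsilon> cont zero by auto
  obtain p where p: "\<And>x. x \<in> F \<Longrightarrow> uniform_limit X (\<lambda>n. hat (p x n)) (r x) sequentially"
    using uniform_approximation_by_image[OF X hat sep r] by metis
  have "\<forall>\<^sub>F n in sequentially. \<forall>y\<in>X.
      dist (\<Sum>x\<in>F. (hat (p x n) y)\<^sup>2 * 1) (\<Sum>x\<in>F. (r x y)\<^sup>2 * 1) < \<epsilon>"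
    using uniform_limitD[OF uniform_limit_weighted_sum_of_squares[OF X p r, where k = "\<lambda>_ _. 1"] \<epsilon>]
    by simp
  moreover have "\<forall>\<^sub>F n in sequentially. \<forall>s\<in>S. \<forall>y\<in>X.
      dist (\<Sum>x\<in>F. (hat (p x n) y)\<^sup>2 * hat (c x s) y) (\<Sum>x\<in>F. (r x y)\<^sup>2 * hat (c x s) y) < \<epsilon> / 2"
  proof (intro eventually_ball_finite[OF S] ballI)
    fix s assume "s \<in> S"
    show "\<forall>\<^sub>F n in sequentially. \<forall>y\<in>X.
      dist (\<Sum>x\<in>F. (hat (p x n) y)\<^sup>2 * hat (c x s) y) (\<Sum>x\<in>F. (r x y)\<^sup>2 * hat (c x s) y) < \<epsilon> / 2"
      using \<epsilon> by (intro uniform_limitD[OF uniform_limit_weighted_sum_of_squares[OF X p r cont]]) auto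
  qed
  ultimately have "\<forall>\<^sub>F n in sequentially.
      (\<forall>y\<in>X. dist (\<Sum>x\<in>F. (hat (p x n) y)\<^sup>2 * 1) (\<Sum>x\<in>F. (r x y)\<^sup>2 * 1) < \<epsilon>) \<and>
      (\<forall>s\<in>S. \<forall>y\<in>X. dist (\<Sum>x\<in>F. (hat (p x n) y)\<^sup>2 * hat (c x s) y)
         (\<Sum>x\<in>F. (r x y)\<^sup>2 * hat (c x s) y) < \<epsilon> / 2)"
    by (rule eventually_conj)
  then obtain n where
    n1: "\<And>y. y \<in> X \<Longrightarrow> dist (\<Sum>x\<in>F. (hat (p x n) y)\<^sup>2 * 1) (\<Sum>x\<in>F. (r x y)\<^sup>2 * 1) < \<epsilon>" and
    n2: "\<And>s y. s \<in> S \<Longrightarrow> y \<in> X \<Longrightarrow> dist (\<Sum>x\<in>F. (hat (p x n) y)\<^sup>2 * hat (c x s) y)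
         (\<Sum>x\<in>F. (r x y)\<^sup>2 * hat (c x s) y) < \<epsilon> / 2"
    using eventually_happens'[OF sequentially_bot] by (smt (verit))
  show thesis
  proof (rule that[OF F, of "\<lambda>x. p x n"])
    show "\<bar>hat (1 - (\<Sum>x\<in>F. (p x n)\<^sup>2)) y\<bar> < \<epsilon>" if "y \<in> X" for y
      using n1[OF that] r_one[OF that]
      by (simp add: real_alg_hom_simps[OF hom[OF that]] dist_real_def abs_minus_commute)
    show "\<bar>hat (\<Sum>x\<in>F. (p x n)\<^sup>2 * c x s) y\<bar> < \<epsilon>" if "y \<in> X" "s \<in> S" for y s
    proof -
      have "\<bar>\<Sum>x\<in>F. (hat (p x n) y)\<^sup>2 * hat (c x s) y\<bar> < \<epsilon>"
        using n2[OF that(2,1)] r_small[OF that] unfolding dist_real_def by linarith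
      then show ?thesis
        by (simp add: real_alg_hom_simps[OF hom[OF that(1)]])
    qed
  qed
qed

section \<open>Gluing the local representations\<close>

theorem theorem4p1:
  fixes \<phi> :: "'b::{real_algebra, comm_ring, comm_monoid_mult} \<Rightarrow>
               'a::{real_algebra, comm_ring, comm_monoid_mult}"
    and hat :: "'b \<Rightarrow> 'x::t2_space \<Rightarrow> real"
    and X :: "'x set"
    and M W :: "'a set"
  assumes "compact X"
    and "real_alg_hom \<phi>"
    and "real_alg_hom_into_C X hat"
    and "image_separates_points X hat"
    and "quadratic_module M"
    and "\<And>b. (\<forall>x\<in>X. hat b x > 0) \<Longrightarrow> \<phi> b \<in> M"
    and "fin_gen_submodule_via \<phi> W"
  shows "(\<Inter>x\<in>X. M + J_at \<phi> hat x W) \<subseteq> ddagger M"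
proof
  fix f assume f: "f \<in> (\<Inter>x\<in>X. M + J_at \<phi> hat x W)"
  note \<phi> = real_alg_hom_simps[OF assms(2)]
  have hom: "real_alg_hom (\<lambda>b. hat b x)" if "x \<in> X" for x
    using assms(3) that by (simp add: real_alg_hom_into_C_def)
  obtain S where S: "finite S" and W: "W = submodule_via \<phi> hull S"
    using assms(7) unfolding fin_gen_submodule_via_def by blast
  have "\<exists>m c. m \<in> M \<and> (\<forall>s. hat (c s) x = 0) \<and> f = m + (\<Sum>s\<in>S. s * \<phi> (c s))"
    if x: "x \<in> X" for x
  proof -
    obtain m j where "m \<in> M" "j \<in> J_at \<phi> hat x W" "f = m + j"
      using f x by (auto simp: set_plus_def)
    then show ?thesis
      using J_at_as_combinations[where hat = hat, OF assms(2) hom[OF x] S] unfolding W by metis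
  qed
  then obtain m c where m: "\<And>x. x \<in> X \<Longrightarrow> m x \<in> M"
    and c: "\<And>x s. x \<in> X \<Longrightarrow> hat (c x s) x = 0"
    and f_eq: "\<And>x. x \<in> X \<Longrightarrow> f = m x + (\<Sum>s\<in>S. s * \<phi> (c x s))"
    by metis
  \<comment> \<open>The direction of perturbation has to be fixed before \<open>\<epsilon>\<close> is given.\<close>
  define q :: "'a \<Rightarrow> 'a" where "q w = (1/2) *\<^sub>R (w\<^sup>2 + 1)" for w
  have "f + \<epsilon> *\<^sub>R (q f + (\<Sum>s\<in>S. q s)) \<in> M" if \<epsilon>: "\<epsilon> > 0" for \<epsilon>
  proof -
    obtain F b where F: "finite F" "F \<subseteq> X"
      and b1: "\<And>y. y \<in> X \<Longrightarrow> \<bar>hat (1 - (\<Sum>x\<in>F. (b x)\<^sup>2)) y\<bar> < \<epsilon>"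
      and b2: "\<And>y s. y \<in> X \<Longrightarrow> s \<in> S \<Longrightarrow> \<bar>hat (\<Sum>x\<in>F. (b x)\<^sup>2 * c x s) y\<bar> < \<epsilon>"
      using square_weights_in_algebra[OF assms(1,3,4) S \<epsilon>, of c] c by auto
    define u where "u = 1 - (\<Sum>x\<in>F. (b x)\<^sup>2)"
    define v where "v s = (\<Sum>x\<in>F. (b x)\<^sup>2 * c x s)" for s
    \<comment> \<open>The weights sum to \<open>1 - u\<close>; the defect \<open>f \<phi>(u)\<close> is a small term like the others,
      with \<open>f\<close> itself as generator.\<close>
    have "f = f * \<phi> u + (\<Sum>x\<in>F. (\<phi> (b x))\<^sup>2 * f)"
      by (simp add: u_def \<phi> right_diff_distrib sum_distrib_left mult.commute)
    also have "(\<Sum>x\<in>F. (\<phi> (b x))\<^sup>2 * f)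
        = (\<Sum>x\<in>F. (\<phi> (b x))\<^sup>2 * m x + (\<Sum>s\<in>S. s * \<phi> ((b x)\<^sup>2 * c x s)))"
    proof (intro sum.cong refl)
      fix x assume "x \<in> F"
      then have "x \<in> X" using F(2) by blast
      show "(\<phi> (b x))\<^sup>2 * f = (\<phi> (b x))\<^sup>2 * m x + (\<Sum>s\<in>S. s * \<phi> ((b x)\<^sup>2 * c x s))"
        by (subst f_eq[OF \<open>x \<in> X\<close>]) (simp add: distrib_left sum_distrib_left \<phi> mult.left_commute)
    qed
    also have "\<dots> = (\<Sum>x\<in>F. (\<phi> (b x))\<^sup>2 * m x) + (\<Sum>s\<in>S. s * \<phi> (v s))"
    proof -
      have "(\<Sum>x\<in>F. \<Sum>s\<in>S. s * \<phi> ((b x)\<^sup>2 * c x s)) = (\<Sum>s\<in>S. s * \<phi> (v s))"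
        by (subst sum.swap) (simp add: v_def \<phi>(9) sum_distrib_left)
      then show ?thesis
        by (simp only: sum.distrib)
    qed
    finally have "f + \<epsilon> *\<^sub>R (q f + (\<Sum>s\<in>S. q s))
        = (f * \<phi> u + (\<Sum>x\<in>F. (\<phi> (b x))\<^sup>2 * m x) + (\<Sum>s\<in>S. s * \<phi> (v s)))
          + \<epsilon> *\<^sub>R (q f + (\<Sum>s\<in>S. q s))"
      by (simp add: add.assoc)
    also have "\<dots> = (f * \<phi> u + \<epsilon> *\<^sub>R q f) + (\<Sum>x\<in>F. (\<phi> (b x))\<^sup>2 * m x)
          + (\<Sum>s\<in>S. s * \<phi> (v s) + \<epsilon> *\<^sub>R q s)"
      by (simp add: scaleR_add_right scaleR_sum_right sum.distrib)
    also have "\<dots> \<in> M"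
    proof (rule quadratic_module_add[OF assms(5) quadratic_module_add[OF assms(5)]];
        (rule quadratic_module_sum[OF assms(5)])?)
      show "f * \<phi> u + \<epsilon> *\<^sub>R q f \<in> M"
        unfolding q_def u_def
        using assms(6) b1 by (intro perturbation_in_quadratic_module[OF assms(2) hom assms(5)])
      show "s * \<phi> (v s) + \<epsilon> *\<^sub>R q s \<in> M" if "s \<in> S" for s
        unfolding q_def v_def
        using assms(6) b2 that by (intro perturbation_in_quadratic_module[OF assms(2) hom assms(5)])
      show "(\<phi> (b x))\<^sup>2 * m x \<in> M" if "x \<in> F" for x
        using that F(2) m by (intro quadratic_module_square_mult[OF assms(5)]) auto
    qed
    finally show ?thesis .
  qed
  then show "f \<in> ddagger M"
    unfolding ddagger_def by blast
qed

end
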